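(* The following statements are equivalent for every $E\in\mathcal{SP}$. (i) $E\in\hat{I}(\mathcal{SP})$. (ii) The pair $\{E,A\}$ is coherently porous for every $A\in\mathcal{SP}$. (iii) The set $E\cup A$ is strongly porous at $0$ for every $A\in\mathcal{SP}$. (iv) Either $0\notin\overline{E\setminus\{0\}}$ or, for every $q>1$, there is an infinite sequence $((a_i,b_i))_{i\in\mathbb{N}}$ of open intervals such that $$Cc^1(E(q))=((a_i,b_i))_{i\in\mathbb{N}}\quad\text{and}\quad\limsup_{i\to\infty}\frac{b_i}{a_i}<\infty.$$
   Context: $\mathbb{R}^+=[0,\infty)$. For $E\subseteq\mathbb{R}^+$ and $h>0$, $\lambda(E,h)$ denotes the length of the largest open subinterval of $(0,h)$ that contains no point of $E$ (and $\lambda(E,h)=0$ if there is no such nonempty interval). The right upper porosity of $E$ at $0$ is $\overline{p}(E)=\limsup_{h\to 0^+}\frac{\lambda(E,h)}{h}$. The set $E$ is strongly porous at $0$ if $\overline{p}(E)=1$. $\mathcal{SP}$ denotes the set of all subsets of $\mathbb{R}^+$ that are strongly porous at $0$. For $E\subseteq\mathbb{R}^+$, $UMP(E)$ is the set of all sequences $(h_n)_{n\in\mathbb{N}}$ of positive real numbers with $\lim_{n\to\infty}h_n=0$ and $\overline{p}(E)=\lim_{n\to\infty}\frac{\lambda(E,h_n)}{h_n}$. A pair $\{A,B\}$ of subsets of $\mathbb{R}^+$ is coherently porous if $UMP(A)\cap UMP(B)\neq\varnothing$. A nonempty collection $\mathbf{I}$ of subsets of a set $X$ is an ideal on $X$ if: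 (1) $B\in\mathbf{I}$ and $C\subseteq B$ imply $C\in\mathbf{I}$; (2) $B\cup C\in\mathbf{I}$ for all $B,C\in\mathbf{I}$; (3) $X\notin\mathbf{I}$. An ideal $\mathbf{I}$ on $\mathbb{R}^+$ is $\mathcal{SP}$-maximal if $\mathbf{I}\subseteq\mathcal{SP}$ and, for every ideal $\mathbf{J}$ on $\mathbb{R}^+$, $\mathbf{I}\subseteq\mathbf{J}\subseteq\mathcal{SP}$ implies $\mathbf{I}=\mathbf{J}$. $\hat{I}(\mathcal{SP})$ is the intersection of all $\mathcal{SP}$-maximal ideals. For $q>1$ and $E\subseteq\mathbb{R}^+$ the $q$-blow up of $E$ is $E(q)=\bigcup_{x\in E}(q^{-1}x,qx)$ (the point $x=0$ contributes the empty set). $Cc^1(E(q))$ denotes the set of connected components of $(0,1)\cap E(q)$. The notation $Cc^1(E(q))=((a_i,b_i))_{i\in\mathbb{N}}$ means that this set of components is infinite and is enumerated in decreasing order by the sequence: every component equals $(a_i,b_i)$ for exactly one $i$, $b_{i+1}\le a_i<b_i$ for every $i\in\mathbb{N}$, and $(0,1)\cap E(q)=\bigcup_{i=1}^{\infty}(a_i,b_i)$. $\overline{E\setminus\{0\}}$ is the closure of $E\setminus\{0\}$. *)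

theory Defs
  imports "HOL-Analysis.Analysis"
begin

abbreviation Rplus :: "real set"
  where "Rplus \<equiv> {0..}"

text \<open>The supremum below is attained, by compactness of the set of admissible endpoint pairs, so it
  is the length of a largest gap. The degenerate pairs with \<open>a = b\<close> supply the value \<open>0\<close> when
  there is no nonempty gap.\<close>

definition gap_length :: "real set \<Rightarrow> real \<Rightarrow> real"
  where "gap_length E h =
    Sup {b - a | a b. 0 \<le> a \<and> a \<le> b \<and> b \<le> h \<and> {a<..<b} \<inter> E = {}}"

definition upper_porosity :: "real set \<Rightarrow> ereal"
  where "upper_porosity E = Limsup (at_right 0) (\<lambda>h. ereal (gap_length E h / h))"

definition strongly_porous :: "real set \<Rightarrow> bool"
  where "strongly_porous E \<longleftrightarrow> upper_porosity E = 1"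

definition SP :: "real set set"
  where "SP = {E. E \<subseteq> Rplus \<and> strongly_porous E}"

definition UMP :: "real set \<Rightarrow> (nat \<Rightarrow> real) set"
  where "UMP E = {h. (\<forall>n. 0 < h n) \<and> h \<longlonglongrightarrow> 0 \<and>
    (\<lambda>n. ereal (gap_length E (h n) / h n)) \<longlonglongrightarrow> upper_porosity E}"

definition coherently_porous :: "real set \<Rightarrow> real set \<Rightarrow> bool"
  where "coherently_porous A B \<longleftrightarrow> UMP A \<inter> UMP B \<noteq> {}"

definition ideal_on :: "'a set \<Rightarrow> 'a set set \<Rightarrow> bool"
  where "ideal_on X I \<longleftrightarrow>
    I \<noteq> {} \<and> I \<subseteq> Pow X \<and>
    (\<forall>B C. B \<in> I \<and> C \<subseteq> B \<longrightarrow> C \<in> I) \<and>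
    (\<forall>B\<in>I. \<forall>C\<in>I. B \<union> C \<in> I) \<and>
    X \<notin> I"

definition SP_maximal :: "real set set \<Rightarrow> bool"
  where "SP_maximal I \<longleftrightarrow>
    ideal_on Rplus I \<and> I \<subseteq> SP \<and>
    (\<forall>J. ideal_on Rplus J \<and> I \<subseteq> J \<and> J \<subseteq> SP \<longrightarrow> I = J)"

definition SP_hat :: "real set set"
  where "SP_hat = \<Inter> {I. SP_maximal I}"

definition blow_up :: "real \<Rightarrow> real set \<Rightarrow> real set"
  where "blow_up q E = (\<Union>x\<in>E. {inverse q * x <..< q * x})"

definition Cc1 :: "real set \<Rightarrow> real set set"
  where "Cc1 S = components ({0<..<1} \<inter> S)"

text \<open>The set of components of \<open>{0<..<1} \<inter> S\<close> is infinite and enumerated, without repetition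
  and in decreasing order, by the intervals \<open>{a i<..<b i}\<close>. Infinity of the set is contained in
  the bijection with \<^typ>\<open>nat\<close>.\<close>

definition Cc1_enumeration :: "real set \<Rightarrow> (nat \<Rightarrow> real) \<Rightarrow> (nat \<Rightarrow> real) \<Rightarrow> bool"
  where "Cc1_enumeration S a b \<longleftrightarrow>
    bij_betw (\<lambda>i. {a i<..<b i}) UNIV (Cc1 S) \<and>
    (\<forall>i. b (Suc i) \<le> a i \<and> a i < b i) \<and>
    {0<..<1} \<inter> S = (\<Union>i. {a i<..<b i})"

end

theory Submission
  imports Defs
begin

text \<open>Everything rests on a reformulation of strong porosity: \<open>E\<close> is strongly porous at \<open>0\<close> iff,
  for every ratio \<open>K > 1\<close>, there are arbitrarily small \<open>t > 0\<close> such that \<open>E\<close> misses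
  \<open>{t/K<..<t}\<close> (\<open>strongly_porous_iff_gaps\<close>). The multiplicative form of the gaps suits the blow up:
  \<open>y\<close> lies outside \<open>E(q)\<close> iff \<open>E\<close> misses \<open>{y/q<..<q * y}\<close>.

  Coherent porosity of two strongly porous sets is the same as strong porosity of their union: a
  porosity ratio close to \<open>1\<close> at \<open>h\<close> forces a gap that covers almost all of \<open>{0<..<h}\<close>, so two such
  gaps at the same \<open>h\<close> overlap in a gap of large ratio, and conversely the right endpoints of the
  gaps of the union serve both sets (\<open>coherently_porous_iff_union\<close>).

  The class \<open>SP\<close> is closed under subsets and does not contain \<open>Rplus\<close>. Hence each \<open>A \<in> SP\<close> lies in
  some maximal ideal, by Zorn's lemma, and this ideal contains \<open>E \<union> A\<close> if \<open>E\<close> lies in all of them.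
  Conversely, if all the unions \<open>E \<union> A\<close> are in \<open>SP\<close>, then \<open>E\<close> can be adjoined to any maximal ideal
  without leaving \<open>SP\<close> (\<open>SP_hat_iff_union\<close>).

  For the geometric condition, assume that the components of \<open>E(q)\<close> near \<open>0\<close> have bounded ratios.
  Then for every gap of \<open>A\<close> near \<open>0\<close> of sufficiently large ratio, either \<open>E\<close> misses its rightmost part
  of ratio \<open>q\<close>, or that part meets a component whose left endpoint \<open>c\<close> is still inside the gap; as \<open>c \<notin> E(q)\<close>, the interval
  \<open>{c/q<..<c}\<close> is a common gap of \<open>E\<close> and \<open>A\<close> (\<open>strongly_porous_Un_of_bounded_components\<close>).
  Conversely, the test set \<open>A = Rplus - E(q)\<close> never leaves a gap of ratio \<open>q\<^sup>2\<close> together with \<open>E\<close>, so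
  if the condition on unions holds then \<open>A\<close> is not strongly porous. This bounds the ratios of
  all intervals near \<open>0\<close> that are contained in \<open>E(q)\<close>, in particular of its components
  (\<open>bounded_components_of_strongly_porous_Un\<close>). The components can be listed in decreasing order
  because each of them, except possibly the one that ends at \<open>1\<close>, has ratio at least \<open>q\<^sup>2\<close>.\<close>

section \<open>Strong porosity as a property of gaps\<close>

lemma bdd_above_gaps:
  "bdd_above {b - a | a b. 0 \<le> a \<and> a \<le> b \<and> b \<le> (h::real) \<and> {a<..<b} \<inter> E = {}}"
  by (rule bdd_aboveI[where M = h]) auto

lemma gap_length_le:
  assumes "0 \<le> h"
  shows "gap_length E h \<le> h"
  unfolding gap_length_def
  using assms by (intro cSup_least) (auto intro!: exI[of _ 0])

lemma less_gap_lengthD: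
  assumes "0 \<le> h" "c < gap_length E h"
  obtains a b where "0 \<le> a" "a \<le> b" "b \<le> h" "{a<..<b} \<inter> E = {}" "c < b - a"
proof -
  have "{b - a | a b. 0 \<le> a \<and> a \<le> b \<and> b \<le> h \<and> {a<..<b} \<inter> E = {}} \<noteq> {}"
    using assms(1) by (auto intro!: exI[of _ 0])
  from less_cSupE[OF assms(2)[unfolded gap_length_def] this] obtain x where
    "x \<in> {b - a | a b. 0 \<le> a \<and> a \<le> b \<and> b \<le> h \<and> {a<..<b} \<inter> E = {}}" "c < x" .
  then show thesis
    by (auto intro: that)
qed

lemma gap_ratio_le_1: "0 < h \<Longrightarrow> gap_length E h / h \<le> 1"
  using gap_length_le[of h E] by simp

lemma gap_ratio_ge:
  assumes "0 < t" "1 < K" "{t/K<..<t} \<inter> E = {}"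
  shows "1 - 1/K \<le> gap_length E t / t"
proof -
  have "t - t/K \<le> gap_length E t"
    unfolding gap_length_def
  proof (rule cSup_upper[OF _ bdd_above_gaps])
    have "t/K \<le> t" using assms by (simp add: field_simps)
    then show "t - t/K \<in> {b - a | a b. 0 \<le> a \<and> a \<le> b \<and> b \<le> t \<and> {a<..<b} \<inter> E = {}}"
      using assms by force
  qed
  then show ?thesis
    using assms(1) by (simp add: field_simps)
qed

text \<open>A gap \<open>{a<..<b}\<close> within \<open>{0<..<h}\<close> of length more than \<open>h - h/(K+1)\<close> has \<open>a < h/(K+1)\<close> and
  \<open>b > h - h/(K+1)\<close>. It thus contains an interval of ratio \<open>K\<close> that depends on \<open>h\<close> and \<open>K\<close> alone,
  which is what makes the gaps of two different sets comparable.\<close>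

lemma gap_of_ratio:
  assumes "0 < h" "0 < K" "1 - 1/(K+1) < gap_length E h / h"
  shows "{h/(K+1)<..<K*h/(K+1)} \<inter> E = {}"
proof -
  have "h - h/(K+1) < gap_length E h"
    using assms by (simp add: field_simps)
  then obtain a b where ab: "0 \<le> a" "a \<le> b" "b \<le> h" "{a<..<b} \<inter> E = {}" "h - h/(K+1) < b - a"
    using less_gap_lengthD[OF less_imp_le[OF assms(1)]] by blast
  have "K*h/(K+1) = h - h/(K+1)"
    using assms(2) by (simp add: field_simps)
  then have "a \<le> h/(K+1)" "K*h/(K+1) \<le> b"
    using ab by linarith+
  then have "{h/(K+1)<..<K*h/(K+1)} \<subseteq> {a<..<b}"
    by auto
  then show ?thesis
    using ab(4) by blast
qed

text \<open>As a gap of ratio \<open>K\<close> ending at \<open>t\<close> has relative length \<open>1 - 1/K\<close> in \<open>{0<..<t}\<close>, relative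
  lengths tending to \<open>1\<close> correspond to ratios tending to infinity.\<close>

theorem strongly_porous_iff_gaps:
  "strongly_porous E \<longleftrightarrow>
    (\<forall>K>1. \<forall>\<epsilon>>0. \<exists>t. 0 < t \<and> t < \<epsilon> \<and> {t/K<..<t} \<inter> E = {})"
    (is "_ \<longleftrightarrow> ?gaps")
proof
  assume "strongly_porous E"
  then have lim: "upper_porosity E = 1"
    by (simp add: strongly_porous_def)
  show ?gaps
  proof (intro allI impI, rule ccontr)
    fix K \<epsilon> :: real
    assume K: "1 < K" and \<epsilon>: "0 < \<epsilon>"
      and no_gap: "\<not> (\<exists>t. 0 < t \<and> t < \<epsilon> \<and> {t/K<..<t} \<inter> E = {})"
    have "gap_length E h / h \<le> 1 - 1/(K+1)" if h: "0 < h" "h < \<epsilon>" for h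
    proof (rule ccontr)
      assume "\<not> ?thesis"
      then have "{h/(K+1)<..<K*h/(K+1)} \<inter> E = {}"
        using gap_of_ratio[of h K E] h K by simp
      then have "{(K*h/(K+1))/K<..<K*h/(K+1)} \<inter> E = {}"
        using K by simp
      moreover have "0 < K*h/(K+1)" "K*h/(K+1) < \<epsilon>"
        using h K \<epsilon> by (auto simp: field_simps intro: add_strict_increasing2 mult_strict_left_mono)
      ultimately show False
        using no_gap by blast
    qed
    then have "eventually (\<lambda>h. ereal (gap_length E h / h) \<le> ereal (1 - 1/(K+1))) (at_right 0)"
      unfolding eventually_at_right_field using \<epsilon> by auto
    then have "upper_porosity E \<le> ereal (1 - 1/(K+1))"
      unfolding upper_porosity_def by (rule Limsup_bounded)
    with lim K show False by (simp add: one_ereal_def)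
  qed
next
  assume gaps: ?gaps
  have "eventually (\<lambda>h. ereal (gap_length E h / h) \<le> 1) (at_right 0)"
    unfolding eventually_at_right_field one_ereal_def
    using gap_ratio_le_1 by (auto intro: exI[of _ 1])
  then have "upper_porosity E \<le> 1"
    unfolding upper_porosity_def by (rule Limsup_bounded)
  moreover have "\<not> upper_porosity E < 1"
  proof
    assume "upper_porosity E < 1"
    then obtain y where y: "upper_porosity E < ereal y" "ereal y < 1"
      using ereal_dense2 by blast
    then have "eventually (\<lambda>h. ereal (gap_length E h / h) < ereal y) (at_right 0)"
      unfolding upper_porosity_def by (intro Limsup_lessD)
    then obtain \<epsilon> where \<epsilon>: "0 < \<epsilon>" "\<And>h. 0 < h \<Longrightarrow> h < \<epsilon> \<Longrightarrow> gap_length E h / h < y"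
      unfolding eventually_at_right_field by auto
    \<comment> \<open>a ratio so large that \<open>1 - 1/K \<ge> y\<close>; the summand \<open>2\<close> ensures \<open>K > 1\<close>\<close>
    define K where "K = 2 + 1/(1 - y)"
    have "y < 1" using y by (simp add: one_ereal_def)
    then have "1 < K" "1/(1 - y) \<le> K"
      by (auto simp: K_def intro: add_pos_pos)
    then have K: "1 < K" "y \<le> 1 - 1/K"
      using \<open>y < 1\<close> by (auto simp: field_simps)
    with gaps \<epsilon>(1) obtain t where t: "0 < t" "t < \<epsilon>" "{t/K<..<t} \<inter> E = {}"
      by blast
    from gap_ratio_ge[OF t(1) K(1) t(3)] \<epsilon>(2)[OF t(1,2)] K(2) show False
      by linarith
  qed
  ultimately show "strongly_porous E"
    by (simp add: strongly_porous_def)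
qed

lemma strongly_porous_subset:
  "strongly_porous B \<Longrightarrow> C \<subseteq> B \<Longrightarrow> strongly_porous C"
proof -
  assume B: "strongly_porous B" and "C \<subseteq> B"
  then have "{a<..<b} \<inter> C = {}" if "{a<..<b} \<inter> B = {}" for a b
    using that by blast
  with B show "strongly_porous C"
    unfolding strongly_porous_iff_gaps by metis
qed

lemma SP_subset: "B \<in> SP \<Longrightarrow> C \<subseteq> B \<Longrightarrow> C \<in> SP"
  unfolding SP_def using strongly_porous_subset by blast

lemma Rplus_notin_SP: "Rplus \<notin> SP"
proof
  assume "Rplus \<in> SP"
  then obtain t :: real where t: "0 < t" "{t/2<..<t} \<inter> Rplus = {}"
    using strongly_porous_iff_gaps[THEN iffD1, rule_format, of Rplus 2 1] by (auto simp: SP_def)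
  have "3*t/4 \<in> {t/2<..<t}" "3*t/4 \<in> Rplus"
    using t(1) by auto
  with t(2) show False by blast
qed

section \<open>Coherent porosity\<close>

theorem coherently_porous_iff_union:
  assumes "strongly_porous A" "strongly_porous B"
  shows "coherently_porous A B \<longleftrightarrow> strongly_porous (A \<union> B)"
proof
  have lim: "(\<lambda>n. ereal (gap_length A (h n) / h n)) \<longlonglongrightarrow> upper_porosity A \<longleftrightarrow>
      (\<lambda>n. gap_length A (h n) / h n) \<longlonglongrightarrow> 1" if "strongly_porous A" for A h
    using that by (simp add: strongly_porous_def one_ereal_def)
  {
    assume "coherently_porous A B"
    then obtain h where h: "\<And>n. 0 < h n" "h \<longlonglongrightarrow> 0"
        "(\<lambda>n. gap_length A (h n) / h n) \<longlonglongrightarrow> 1" "(\<lambda>n. gap_length B (h n) / h n) \<longlonglongrightarrow> 1"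
      using assms by (auto simp: coherently_porous_def UMP_def lim)
    show "strongly_porous (A \<union> B)"
      unfolding strongly_porous_iff_gaps
    proof (intro allI impI)
      fix K \<epsilon> :: real
      assume K: "1 < K" and \<epsilon>: "0 < \<epsilon>"
      have "1 - 1/(K+1) < 1" using K by simp
      then have "eventually (\<lambda>n. h n < \<epsilon> \<and> 1 - 1/(K+1) < gap_length A (h n) / h n \<and>
          1 - 1/(K+1) < gap_length B (h n) / h n) sequentially"
        using order_tendstoD(2)[OF h(2) \<epsilon>] order_tendstoD(1)[OF h(3)] order_tendstoD(1)[OF h(4)]
        by (intro eventually_conj) auto
      then obtain n where n: "h n < \<epsilon>" "1 - 1/(K+1) < gap_length A (h n) / h n"
          "1 - 1/(K+1) < gap_length B (h n) / h n"
        by (auto simp: eventually_sequentially)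
      define t where "t = K * h n / (K+1)"
      have "t/K = h n / (K+1)"
        using K by (simp add: t_def)
      then have "{t/K<..<t} \<inter> (A \<union> B) = {}"
        using gap_of_ratio[OF h(1) _ n(2)] gap_of_ratio[OF h(1) _ n(3)] K
        unfolding t_def by (simp add: Int_Un_distrib)
      moreover have "0 < t" "t < h n"
        using h(1)[of n] K by (auto simp: t_def field_simps)
      ultimately show "\<exists>t. 0 < t \<and> t < \<epsilon> \<and> {t/K<..<t} \<inter> (A \<union> B) = {}"
        using n(1) by (intro exI[of _ t]) auto
    qed
  }
  {
    assume "strongly_porous (A \<union> B)"
    then have "\<forall>n. \<exists>t. 0 < t \<and> t < inverse (real (Suc n)) \<and>
        {t/(real (Suc (Suc n)))<..<t} \<inter> (A \<union> B) = {}"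
      unfolding strongly_porous_iff_gaps by simp
    then obtain h where h: "\<And>n. 0 < h n" "\<And>n. h n < inverse (real (Suc n))"
        "\<And>n. {h n/(real (Suc (Suc n)))<..<h n} \<inter> (A \<union> B) = {}"
      by metis
    have "h \<longlonglongrightarrow> 0"
      by (rule real_tendsto_sandwich[OF _ _ tendsto_const LIMSEQ_inverse_real_of_nat])
        (use h(1,2) in \<open>auto simp: less_imp_le\<close>)
    moreover have "(\<lambda>n. gap_length C (h n) / h n) \<longlonglongrightarrow> 1" if C: "C \<subseteq> A \<union> B" for C
    proof (rule real_tendsto_sandwich[OF _ _ _ tendsto_const])
      have "(\<lambda>n. 1 - inverse (real (Suc (Suc n)))) \<longlonglongrightarrow> 1 - 0"
        by (intro tendsto_diff tendsto_const LIMSEQ_Suc[OF LIMSEQ_inverse_real_of_nat])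
      then show "(\<lambda>n. 1 - 1 / (real (Suc (Suc n)))) \<longlonglongrightarrow> 1"
        by (simp add: inverse_eq_divide del: of_nat_Suc)
      have "1 - 1 / (real (Suc (Suc n))) \<le> gap_length C (h n) / h n" for n
        using gap_ratio_ge[of "h n" "real (Suc (Suc n))" C] h(1,3)[of n] C by auto
      then show "\<forall>\<^sub>F n in sequentially. 1 - 1 / (real (Suc (Suc n))) \<le> gap_length C (h n) / h n"
        by simp
      show "\<forall>\<^sub>F n in sequentially. gap_length C (h n) / h n \<le> 1"
        using gap_ratio_le_1 h(1) by simp
    qed
    ultimately have "h \<in> UMP A \<inter> UMP B"
      using h(1) assms by (simp add: UMP_def lim)
    then show "coherently_porous A B"
      by (auto simp: coherently_porous_def)
  }
qed

section \<open>Ideals of strongly porous sets\<close>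

text \<open>Zorn's lemma applies to the ideals within \<open>SP\<close> that contain \<open>A\<close>: one of them is \<open>Pow A\<close>, and the
  union of a chain is again proper because it stays within \<open>SP\<close>.\<close>

lemma SP_maximal_exists:
  assumes "A \<in> SP"
  obtains I where "SP_maximal I" "A \<in> I"
proof -
  define \<I> where "\<I> = {I. ideal_on Rplus I \<and> I \<subseteq> SP \<and> A \<in> I}"
  have "A \<subseteq> Rplus" using assms by (simp add: SP_def)
  then have "Pow A \<in> \<I>"
    using SP_subset[OF assms] assms Rplus_notin_SP
    by (auto simp: \<I>_def ideal_on_def)
  moreover have "\<Union>\<C> \<in> \<I>" if "\<C> \<noteq> {}" and chain: "subset.chain \<I> \<C>" for \<C>
  proof -
    have \<C>: "\<And>I. I \<in> \<C> \<Longrightarrow> ideal_on Rplus I \<and> I \<subseteq> SP \<and> A \<in> I"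
      and lin: "\<And>I J. I \<in> \<C> \<Longrightarrow> J \<in> \<C> \<Longrightarrow> I \<subseteq> J \<or> J \<subseteq> I"
      using chain unfolding subset_chain_def \<I>_def by blast+
    have "B \<union> C \<in> \<Union>\<C>" if BC: "B \<in> \<Union>\<C>" "C \<in> \<Union>\<C>" for B C
    proof -
      obtain I where "I \<in> \<C>" "B \<in> I" "C \<in> I"
        using BC lin by blast
      then show ?thesis using \<C> unfolding ideal_on_def by blast
    qed
    moreover have "C \<in> \<Union>\<C>" if "B \<in> \<Union>\<C>" "C \<subseteq> B" for B C
      using that \<C> unfolding ideal_on_def by blast
    moreover have "A \<in> \<Union>\<C>"
      using \<C> \<open>\<C> \<noteq> {}\<close> by blast
    moreover have "\<Union>\<C> \<subseteq> SP"
      using \<C> by blast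
    moreover have "\<Union>\<C> \<subseteq> Pow Rplus" "Rplus \<notin> \<Union>\<C>"
      using \<open>\<Union>\<C> \<subseteq> SP\<close> Rplus_notin_SP by (auto simp: SP_def)
    ultimately have "ideal_on Rplus (\<Union>\<C>)"
      unfolding ideal_on_def by (intro conjI) (blast | fast)+
    with \<open>A \<in> \<Union>\<C>\<close> \<open>\<Union>\<C> \<subseteq> SP\<close> show ?thesis
      by (simp add: \<I>_def)
  qed
  ultimately obtain M where M: "M \<in> \<I>" "\<forall>X\<in>\<I>. M \<subseteq> X \<longrightarrow> X = M"
    using subset_Zorn_nonempty[of \<I>] by blast
  then have "SP_maximal M" "A \<in> M"
    unfolding \<I>_def SP_maximal_def by blast+
  then show thesis by (rule that)
qed

theorem SP_hat_iff_union:
  "E \<in> SP_hat \<longleftrightarrow> (\<forall>A\<in>SP. E \<union> A \<in> SP)"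
proof
  assume E: "E \<in> SP_hat"
  show "\<forall>A\<in>SP. E \<union> A \<in> SP"
  proof
    fix A assume "A \<in> SP"
    then obtain I where I: "SP_maximal I" "A \<in> I"
      by (rule SP_maximal_exists)
    then have "E \<in> I" using E by (simp add: SP_hat_def)
    with I show "E \<union> A \<in> SP"
      unfolding SP_maximal_def ideal_on_def by blast
  qed
next
  assume union: "\<forall>A\<in>SP. E \<union> A \<in> SP"
  have "E \<in> I" if I: "SP_maximal I" for I
  proof -
    \<comment> \<open>the ideal generated by \<open>I\<close> and \<open>E\<close>\<close>
    define J where "J = {C. \<exists>B\<in>I. C \<subseteq> E \<union> B}"
    have ideal: "ideal_on Rplus I" and "I \<subseteq> SP"
      using I by (auto simp: SP_maximal_def)
    have "J \<subseteq> SP"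
      using union \<open>I \<subseteq> SP\<close> SP_subset unfolding J_def by blast
    moreover have "I \<subseteq> J"
      unfolding J_def by blast
    moreover have "ideal_on Rplus J"
      unfolding ideal_on_def
    proof (intro conjI allI ballI impI)
      show "J \<noteq> {}"
        using \<open>I \<subseteq> J\<close> ideal by (auto simp: ideal_on_def)
      show "J \<subseteq> Pow Rplus" using \<open>J \<subseteq> SP\<close> by (auto simp: SP_def)
      show "Rplus \<notin> J" using \<open>J \<subseteq> SP\<close> Rplus_notin_SP by blast
      show "C \<in> J" if "B \<in> J \<and> C \<subseteq> B" for B C
        using that unfolding J_def by blast
      show "B \<union> C \<in> J" if BC: "B \<in> J" "C \<in> J" for B C
      proof -
        obtain B' C' where "B' \<in> I" "C' \<in> I" "B \<subseteq> E \<union> B'" "C \<subseteq> E \<union> C'"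
          using BC unfolding J_def by blast
        then have "B' \<union> C' \<in> I" "B \<union> C \<subseteq> E \<union> (B' \<union> C')"
          using ideal unfolding ideal_on_def by blast+
        then show ?thesis unfolding J_def by blast
      qed
    qed
    ultimately have "I = J"
      using I unfolding SP_maximal_def by blast
    moreover have "E \<in> J"
      using ideal unfolding J_def ideal_on_def by blast
    ultimately show ?thesis by simp
  qed
  then show "E \<in> SP_hat"
    by (simp add: SP_hat_def)
qed

section \<open>Blow ups and enumerated components\<close>

lemma mem_blow_up_iff:
  assumes "0 < q"
  shows "y \<in> blow_up q E \<longleftrightarrow> {y/q<..<q * y} \<inter> E \<noteq> {}"
proof -
  have "x \<in> {y/q<..<q * y} \<longleftrightarrow> y \<in> {inverse q * x<..<q * x}" for x
    using assms by (auto simp: field_simps)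
  then show ?thesis
    unfolding blow_up_def by blast
qed

lemma open_blow_up: "open (blow_up q E)"
  unfolding blow_up_def by auto

lemma Cc1_enumeration_decreasing:
  assumes "Cc1_enumeration S a b" "i < j"
  shows "b j \<le> a i"
  using assms(2)
proof (induction rule: strict_inc_induct)
  case (base i)
  then show ?case
    using assms(1) by (auto simp: Cc1_enumeration_def)
next
  case (step i)
  moreover have "a (Suc i) < b (Suc i)" "b (Suc i) \<le> a i"
    using assms(1) by (auto simp: Cc1_enumeration_def)
  ultimately show ?case by linarith
qed

lemma Cc1_enumeration_bounds:
  assumes "Cc1_enumeration S a b"
  shows "0 < a i" "a i < b i" "b i \<le> 1"
proof -
  have less: "a i < b i" "b (Suc i) \<le> a i" for i
    using assms by (auto simp: Cc1_enumeration_def)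
  have "{a i<..<b i} \<subseteq> {0<..<1}" for i
    using assms unfolding Cc1_enumeration_def by blast
  then have "0 \<le> a i" "b i \<le> 1" for i
    using less(1)[of i] by (auto simp: greaterThanLessThan_subseteq_greaterThanLessThan)
  then show "0 < a i" "a i < b i" "b i \<le> 1"
    using less[of i] less(1)[of "Suc i"] by (auto intro: le_less_trans[of 0 "a (Suc i)"])
qed

text \<open>No other component can contain \<open>a i\<close>: it would overlap \<open>{a i<..<b i}\<close>.\<close>

lemma Cc1_enumeration_left_endpoint:
  assumes "Cc1_enumeration S a b"
  shows "a i \<notin> S"
proof
  assume "a i \<in> S"
  moreover have "a i \<in> {0<..<1}"
    using Cc1_enumeration_bounds[OF assms, of i] by auto
  ultimately obtain j where "a i \<in> {a j<..<b j}"
    using assms unfolding Cc1_enumeration_def by blast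
  then have j: "a j < a i" "a i < b j" by auto
  moreover have "a i < b i"
    by (rule Cc1_enumeration_bounds[OF assms])
  ultimately show False
    using Cc1_enumeration_decreasing[OF assms, of i j]
      Cc1_enumeration_decreasing[OF assms, of j i] by (cases i j rule: linorder_cases) auto
qed

text \<open>For a gap of ratio \<open>K\<close> the blow up factor is chosen as \<open>q = K\<close>. Let \<open>M\<close> bound the ratios of
  the components of the blow up near \<open>0\<close>, and let \<open>{t/(K * K * M)<..<t}\<close> be a gap of \<open>A\<close>. If \<open>E\<close> does not
  miss \<open>{t/K<..<t}\<close>, a point \<open>x\<close> of \<open>E\<close> in there lies in a component, whose left endpoint is larger than
  \<open>x/M\<close> and hence than \<open>t/(K * M)\<close>. This leaves room for a gap of ratio \<open>K\<close> to the left of the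
  endpoint.\<close>

theorem strongly_porous_Un_of_bounded_components:
  assumes A: "strongly_porous A"
    and enum: "\<And>q. 1 < q \<Longrightarrow> \<exists>a b. Cc1_enumeration (blow_up q E) a b
                  \<and> limsup (\<lambda>i. ereal (b i / a i)) < \<infinity>"
  shows "strongly_porous (E \<union> A)"
  unfolding strongly_porous_iff_gaps
proof (intro allI impI)
  fix K \<epsilon> :: real
  assume K: "1 < K" and \<epsilon>: "0 < \<epsilon>"
  obtain a b where ab: "Cc1_enumeration (blow_up K E) a b"
    and "limsup (\<lambda>i. ereal (b i / a i)) < \<infinity>"
    using enum[OF K] by blast
  then obtain M where "limsup (\<lambda>i. ereal (b i / a i)) < ereal M"
    using ereal_dense2 by blast
  from Limsup_lessD[OF this] obtain N where N: "\<And>i. N \<le> i \<Longrightarrow> b i / a i < M"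
    by (auto simp: eventually_sequentially)
  note bounds = Cc1_enumeration_bounds[OF ab]
  have "1 < b N / a N"
    using bounds(1,2)[of N] by simp
  with N[of N] have M: "1 < M" by simp
  have "1 < K * K * M"
    using K M by (simp add: less_1_mult)
  moreover have "0 < min \<epsilon> (a N)"
    using \<epsilon> bounds(1) by simp
  ultimately obtain t where t: "0 < t" "t < \<epsilon>" "t < a N" "{t/(K * K * M)<..<t} \<inter> A = {}"
    using A unfolding strongly_porous_iff_gaps by (meson min_less_iff_conj)
  have sub: "{s/K<..<s} \<inter> A = {}" if "t/(K * M) \<le> s" "s \<le> t" for s
  proof -
    have "t/(K * K * M) \<le> s/K"
      using that K M by (simp add: field_simps)
    then have "{s/K<..<s} \<subseteq> {t/(K * K * M)<..<t}"
      using that by auto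
    then show ?thesis using t(4) by blast
  qed
  show "\<exists>t. 0 < t \<and> t < \<epsilon> \<and> {t/K<..<t} \<inter> (E \<union> A) = {}"
  proof (cases "{t/K<..<t} \<inter> E = {}")
    case True
    have "t/(K * M) \<le> t"
      using t(1) less_1_mult[OF K M] by (simp add: field_simps)
    then show ?thesis
      using True sub[of t] t(1,2) by (intro exI[of _ t]) (simp add: Int_Un_distrib)
  next
    case False
    then obtain x where x: "x \<in> E" "t/K < x" "x < t" by auto
    have "0 < x" using x(2) t(1) K by (meson divide_pos_pos less_trans zero_less_one)
    then have "x \<in> {x/K<..<K * x} \<inter> E"
      using x(1) K by (simp add: field_simps)
    then have "x \<in> blow_up K E"
      using mem_blow_up_iff[of K x E] K by auto
    moreover have "x \<in> {0<..<1}"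
      using \<open>0 < x\<close> x(3) t(3) bounds[of N] by simp
    ultimately obtain i where i: "a i < x" "x < b i"
      using ab unfolding Cc1_enumeration_def by (auto simp: set_eq_iff)
    \<comment> \<open>since \<open>x < t < a N\<close>, the component is one of those with ratio less than \<open>M\<close>\<close>
    have "N \<le> i"
    proof (rule ccontr)
      assume "\<not> N \<le> i"
      then have "a N < a i"
        using Cc1_enumeration_decreasing[OF ab, of i N] bounds(2)[of N] by auto
      then show False using i x(3) t(3) by linarith
    qed
    have "t < K * x"
      using x(2) K by (simp add: field_simps)
    also have "K * x < K * b i"
      using i(2) K by simp
    also have "\<dots> \<le> K * (M * a i)"
      using N[OF \<open>N \<le> i\<close>] bounds(1)[of i] K by (simp add: field_simps)
    finally have "t/(K * M) \<le> a i"
      using K M by (simp add: field_simps)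
    then have "{a i/K<..<a i} \<inter> A = {}"
      using sub i x(3) by simp
    moreover have "{a i/K<..<a i} \<inter> E = {}"
    proof -
      have "{a i/K<..<K * a i} \<inter> E = {}"
        using Cc1_enumeration_left_endpoint[OF ab, of i] mem_blow_up_iff[of K "a i" E] K by auto
      moreover have "a i \<le> K * a i"
        using bounds(1)[of i] K by simp
      ultimately show ?thesis by force
    qed
    ultimately show ?thesis
      using bounds(1)[of i] i x(3) t(2) by (intro exI[of _ "a i"]) (simp add: Int_Un_distrib)
  qed
qed

section \<open>Enumerating the components of the blow up\<close>

lemma open_connected_eq_Ioo:
  fixes S :: "real set"
  assumes "open S" "connected S" "S \<subseteq> {l<..<u}" "S \<noteq> {}"
  shows "S = {Inf S<..<Sup S}"
proof (intro equalityI subsetI)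
  have bdd: "bdd_below S" "bdd_above S"
    using assms(3) by (auto intro!: bdd_belowI[of _ l] bdd_aboveI[of _ u])
  {
    fix x assume "x \<in> S"
    moreover have "\<forall>a\<in>S. l < a" "\<forall>a\<in>S. a < u"
      using assms(3) by auto
    then have "Inf S \<notin> S" "Sup S \<notin> S"
      using Inf_notin_open[OF assms(1)] Sup_notin_open[OF assms(1)] by blast+
    ultimately show "x \<in> {Inf S<..<Sup S}"
      using cInf_lower[OF _ bdd(1)] cSup_upper[OF _ bdd(2)] by (metis greaterThanLessThan_iff order_less_le)
  next
    fix x assume x: "x \<in> {Inf S<..<Sup S}"
    then obtain y z where "y \<in> S" "z \<in> S" "y < x" "x < z"
      using cInf_less_iff[OF assms(4) bdd(1)] less_cSup_iff[OF assms(4) bdd(2)] by auto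
    then show "x \<in> S"
      using connected_contains_Icc[OF assms(2), of y z] by auto
  }
qed

lemma Sup_le_Inf_of_disjoint:
  fixes a b c d :: real
  assumes "{a<..<b} \<inter> {c<..<d} = {}" "a < b" "c < d" "b \<le> d"
  shows "b \<le> c"
proof (rule ccontr)
  assume "\<not> b \<le> c"
  then obtain x where "max a c < x" "x < b"
    using assms(2) dense[of "max a c" b] by auto
  with assms show False by auto
qed

text \<open>Order the elements by the increasing enumeration of their values under \<open>g\<close>.\<close>

lemma enumerate_by_level:
  fixes g :: "'a \<Rightarrow> nat"
  assumes "infinite C" "inj_on g C"
  obtains f where "bij_betw f UNIV C" "\<And>i. g (f i) < g (f (Suc i))" "\<And>i. i \<le> g (f i)"
proof -
  have inf: "infinite (g ` C)"
    using assms finite_imageD by blast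
  define f where "f = inv_into C g \<circ> enumerate (g ` C)"
  have "bij_betw (inv_into C g) (g ` C) C"
    by (rule bij_betw_inv_into) (simp add: bij_betw_def assms(2))
  then have "bij_betw f UNIV C"
    unfolding f_def using bij_enumerate[OF inf] bij_betw_trans by blast
  moreover have "g (f i) = enumerate (g ` C) i" for i
    unfolding f_def using enumerate_in_set[OF inf] by (simp add: f_inv_into_f)
  ultimately show thesis
    using that[of f] inf le_enumerate[OF inf] by simp
qed

text \<open>The level counts multiplicative steps of size \<open>q\<^sup>2\<close> from \<open>1\<close> down to \<open>s\<close>. Rounding up gives
  the level \<open>0\<close> to \<open>1\<close> but to no \<open>s < 1\<close>, so that the component ending at \<open>1\<close>, which is cut off there and
  may have a ratio below \<open>q\<^sup>2\<close>, does not share its level with another one.\<close>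

definition level :: "real \<Rightarrow> real \<Rightarrow> nat"
  where "level q s = nat \<lceil>- log (q\<^sup>2) s\<rceil>"

lemma level_antimono:
  assumes "1 < q" "0 < s" "s \<le> s'"
  shows "level q s' \<le> level q s"
proof -
  have "1 < q\<^sup>2" using assms(1) by simp
  then have "log (q\<^sup>2) s \<le> log (q\<^sup>2) s'"
    using assms by simp
  then show ?thesis
    unfolding level_def by (intro nat_mono ceiling_mono) simp
qed

text \<open>The hypotheses describe the right endpoints \<open>s < s'\<close> of two components, where only a component
  that ends before \<open>1\<close> is known to have ratio at least \<open>q\<^sup>2\<close>.\<close>

lemma level_less:
  assumes "1 < q" "0 < s" "s < s'" "s' \<le> 1" "s' < 1 \<Longrightarrow> q\<^sup>2 * s \<le> s'"
  shows "level q s' < level q s"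
proof (cases "s' < 1")
  case True
  have q: "1 < q\<^sup>2" using assms(1) by simp
  have "1 + log c s = log c (c * s)" if "1 < c" for c
    using that assms(2) by (simp add: log_mult)
  from this[OF q] have "1 + log (q\<^sup>2) s = log (q\<^sup>2) (q\<^sup>2 * s)" .
  also have "\<dots> \<le> log (q\<^sup>2) s'"
    using assms q True by simp
  finally have "- log (q\<^sup>2) s' + 1 \<le> - log (q\<^sup>2) s" by simp
  then have "\<lceil>- log (q\<^sup>2) s'\<rceil> + 1 \<le> \<lceil>- log (q\<^sup>2) s\<rceil>"
    by (metis ceiling_mono ceiling_add_one)
  moreover have "0 < - log (q\<^sup>2) s'"
    using q True assms by simp
  then have "0 < \<lceil>- log (q\<^sup>2) s'\<rceil>"
    by (simp only: zero_less_ceiling)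
  ultimately show ?thesis
    unfolding level_def by linarith
next
  case False
  then have "s' = 1" using assms by simp
  moreover have "log (q\<^sup>2) s < 0"
    using assms by simp
  ultimately show ?thesis
    unfolding level_def by simp
qed

locale blow_up_components =
  fixes E :: "real set" and q :: real
  assumes q: "1 < q"
begin

abbreviation "CC \<equiv> Cc1 (blow_up q E)"

lemma component_Ioo:
  assumes "S \<in> CC"
  shows "S = {Inf S<..<Sup S}" "Inf S < Sup S" "0 \<le> Inf S" "Sup S \<le> 1"
proof -
  have S: "S \<in> components ({0<..<1} \<inter> blow_up q E)"
    using assms by (simp add: Cc1_def)
  have sub: "S \<subseteq> {0<..<1}"
    using in_components_subset[OF S] by blast
  show eq: "S = {Inf S<..<Sup S}"
    using open_components[OF open_Int[OF open_greaterThanLessThan open_blow_up] S]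
      in_components_connected[OF S] sub in_components_nonempty[OF S]
    by (rule open_connected_eq_Ioo)
  show less: "Inf S < Sup S"
    using in_components_nonempty[OF S] eq by (metis greaterThanLessThan_empty_iff not_le)
  have "{Inf S<..<Sup S} \<subseteq> {0<..<1}"
    using sub eq by simp
  then show "0 \<le> Inf S" "Sup S \<le> 1"
    using less by (auto simp: greaterThanLessThan_subseteq_greaterThanLessThan)
qed

lemma Union_CC: "\<Union>CC = {0<..<1} \<inter> blow_up q E"
  by (simp add: Cc1_def)

lemma components_separated:
  assumes "S \<in> CC" "T \<in> CC" "S \<noteq> T" "Sup S \<le> Sup T"
  shows "Sup S \<le> Inf T"
proof -
  have "S \<inter> T = {}"
    using assms components_nonoverlap unfolding Cc1_def by blast
  then have "{Inf S<..<Sup S} \<inter> {Inf T<..<Sup T} = {}"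
    using component_Ioo(1) assms(1,2) by simp
  then show ?thesis
    using Sup_le_Inf_of_disjoint component_Ioo(2) assms by blast
qed

text \<open>A component contains every blow up interval \<open>{e/q<..<q * e}\<close> that it meets, up to the truncation
  at \<open>1\<close>; the truncation cannot occur if the component ends before \<open>1\<close>.\<close>

lemma component_ratio:
  assumes "S \<in> CC" "Sup S < 1"
  shows "q\<^sup>2 * Inf S \<le> Sup S"
proof -
  have S: "S \<in> components ({0<..<1} \<inter> blow_up q E)"
    using assms by (simp add: Cc1_def)
  obtain x where x: "x \<in> S"
    using in_components_nonempty[OF S] by blast
  then have "0 < x" "x < 1" "x \<in> blow_up q E"
    using in_components_subset[OF S] by auto
  then obtain e where e: "e \<in> E" "inverse q * e < x" "x < q * e"
    unfolding blow_up_def by auto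
  have "0 < e"
    using \<open>0 < x\<close> e(3) q by (meson less_trans zero_less_mult_pos zero_less_one)
  define T where "T = {inverse q * e<..<min (q * e) 1}"
  have conn: "connected T"
    unfolding T_def by simp
  have T_sub: "T \<subseteq> {0<..<1} \<inter> blow_up q E"
  proof
    fix y assume y: "y \<in> T"
    have "0 < inverse q * e"
      using \<open>0 < e\<close> q by simp
    with y have "0 < y" "y < 1" by (auto simp: T_def)
    with y e(1) show "y \<in> {0<..<1} \<inter> blow_up q E"
      unfolding T_def blow_up_def by auto
  qed
  have "x \<in> T"
    using e \<open>x < 1\<close> by (simp add: T_def)
  with x have "T \<subseteq> S"
    using components_maximal[OF S conn T_sub] by blast
  moreover have "inverse q * e < min (q * e) 1"
    using \<open>x \<in> T\<close> unfolding T_def by auto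
  ultimately have "Inf S \<le> inverse q * e" "min (q * e) 1 \<le> Sup S"
    using component_Ioo(1)[OF assms(1)] unfolding T_def
    by (metis greaterThanLessThan_subseteq_greaterThanLessThan)+
  then have "q\<^sup>2 * Inf S \<le> q * e" "q * e \<le> Sup S"
    using assms(2) q by (auto simp: field_simps power2_eq_square)
  then show ?thesis by simp
qed

lemma level_component_less:
  assumes "S \<in> CC" "T \<in> CC" "S \<noteq> T" "Sup S \<le> Sup T"
  shows "level q (Sup T) < level q (Sup S)"
proof (rule level_less[OF q])
  have le: "Sup S \<le> Inf T"
    using components_separated[OF assms] .
  show "0 < Sup S"
    using component_Ioo(2,3)[OF assms(1)] by linarith
  show "Sup S < Sup T" "Sup T \<le> 1"
    using le component_Ioo(2,4)[OF assms(2)] by linarith+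
  show "q\<^sup>2 * Sup S \<le> Sup T" if "Sup T < 1"
  proof -
    have "q\<^sup>2 * Sup S \<le> q\<^sup>2 * Inf T"
      using le by (intro mult_left_mono) auto
    then show ?thesis
      using component_ratio[OF assms(2) that] by linarith
  qed
qed

lemma inj_level_component: "inj_on (\<lambda>S. level q (Sup S)) CC"
proof (rule inj_onI, rule ccontr)
  fix S T assume "S \<in> CC" "T \<in> CC" "level q (Sup S) = level q (Sup T)" "S \<noteq> T"
  then show False
    using level_component_less[of S T] level_component_less[of T S] by force
qed

text \<open>Arbitrarily small gaps of \<open>E\<close> of ratio \<open>q\<^sup>2\<close> yield arbitrarily small positive points outside the
  blow up, namely the geometric centres \<open>t/q\<close> of the gaps.\<close>

lemma Inf_component_pos:
  assumes "strongly_porous E" "S \<in> CC"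
  shows "0 < Inf S"
proof -
  have "1 < q * q" using q by (simp add: less_1_mult)
  moreover have pos: "0 < Sup S"
    using component_Ioo(2,3)[OF assms(2)] by linarith
  ultimately obtain t where t: "0 < t" "t < Sup S" "{t/(q * q)<..<t} \<inter> E = {}"
    using assms(1) unfolding strongly_porous_iff_gaps by blast
  then have "t/q \<notin> blow_up q E"
    using mem_blow_up_iff[of q "t/q" E] q by simp
  then have "t/q \<notin> S"
    using Union_CC assms(2) by blast
  moreover have "0 < t/q" "t/q < t"
    using t(1) q by (auto simp: field_simps)
  ultimately show ?thesis
    using t(2) component_Ioo(1)[OF assms(2)] by (metis greaterThanLessThan_iff less_le_trans less_trans not_le)
qed

text \<open>Finitely many components would stay away from \<open>0\<close>, whereas the positive points of \<open>E\<close>, which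
  lie in the blow up, do not.\<close>

lemma infinite_components:
  assumes "strongly_porous E" "E \<subseteq> Rplus" "0 \<in> closure (E - {0})"
  shows "infinite CC"
proof
  assume "finite CC"
  define m where "m = Min (insert 1 (Inf ` CC))"
  have "0 < m"
    unfolding m_def using \<open>finite CC\<close> Inf_component_pos[OF assms(1)] by auto
  then obtain e where e: "e \<in> E" "e \<noteq> 0" "\<bar>e\<bar> < m"
    using assms(3) unfolding closure_approachable by (auto simp: dist_real_def)
  then have "0 < e" "e < m" using assms(2) by force+
  moreover have "m \<le> 1"
    unfolding m_def using \<open>finite CC\<close> by simp
  moreover have "e \<in> {e/q<..<q * e} \<inter> E"
    using e(1) \<open>0 < e\<close> q by (simp add: field_simps)
  then have "e \<in> blow_up q E"
    using mem_blow_up_iff[of q e E] q by auto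
  ultimately obtain S where S: "S \<in> CC" "e \<in> S"
    using Union_CC by (metis IntI UnionE greaterThanLessThan_iff less_le_trans)
  then have "Inf S < e"
    using component_Ioo(1)[OF S(1)] by auto
  moreover have "m \<le> Inf S"
    unfolding m_def using \<open>finite CC\<close> S(1) by simp
  ultimately show False using \<open>e < m\<close> by simp
qed

theorem Cc1_enumeration_exists:
  assumes "strongly_porous E" "E \<subseteq> Rplus" "0 \<in> closure (E - {0})"
  obtains a b where "Cc1_enumeration (blow_up q E) a b" "b \<longlonglongrightarrow> 0"
proof -
  obtain f where f: "bij_betw f UNIV CC"
    and incr: "\<And>i. level q (Sup (f i)) < level q (Sup (f (Suc i)))"
    and large: "\<And>i. i \<le> level q (Sup (f i))"
    using enumerate_by_level[OF infinite_components[OF assms] inj_level_component] by blast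
  have CC: "f i \<in> CC" for i
    using f by (auto simp: bij_betw_def)
  define a b where "a = (\<lambda>i. Inf (f i))" and "b = (\<lambda>i. Sup (f i))"
  have f_eq: "f = (\<lambda>i. {a i<..<b i})"
    unfolding a_def b_def using component_Ioo(1)[OF CC] by blast
  have "b (Suc i) \<le> a i" for i
  proof -
    have "f (Suc i) \<noteq> f i"
      using incr[of i] by auto
    moreover have "Sup (f (Suc i)) \<le> Sup (f i)"
      using level_component_less[OF CC CC, of i "Suc i"] incr[of i] calculation by force
    ultimately show ?thesis
      unfolding a_def b_def by (intro components_separated CC)
  qed
  moreover have "a i < b i" for i
    unfolding a_def b_def by (rule component_Ioo(2)[OF CC])
  moreover have "{0<..<1} \<inter> blow_up q E = (\<Union>i. {a i<..<b i})"
    using Union_CC f f_eq by (metis bij_betw_imp_surj_on)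
  ultimately have "Cc1_enumeration (blow_up q E) a b"
    unfolding Cc1_enumeration_def using f f_eq by auto
  moreover have "b \<longlonglongrightarrow> 0"
  proof (rule order_tendstoI)
    fix \<epsilon> :: real assume "\<epsilon> < 0"
    moreover have "0 < b i" for i
      unfolding b_def using component_Ioo(2,3)[OF CC] by (metis le_less_trans)
    ultimately show "\<forall>\<^sub>F i in sequentially. \<epsilon> < b i"
      by (simp add: less_trans)
  next
    fix \<epsilon> :: real assume \<epsilon>: "0 < \<epsilon>"
    have "b i < \<epsilon>" if "level q \<epsilon> < i" for i
      using level_antimono[OF q \<epsilon>, of "b i"] large[of i] that unfolding b_def by force
    then show "\<forall>\<^sub>F i in sequentially. b i < \<epsilon>"
      using eventually_mono[OF eventually_gt_at_top[of "level q \<epsilon>"], of "\<lambda>i. b i < \<epsilon>"] by simp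
  qed
  ultimately show thesis by (rule that)
qed

end

text \<open>The test set is \<open>A = Rplus - E(q)\<close>. A gap \<open>{t/q\<^sup>2<..<t}\<close> of \<open>E \<union> A\<close> is impossible: its centre
  \<open>t/q\<close> would not lie in \<open>E(q)\<close>, since \<open>E\<close> has no points in the gap, and so it would belong to \<open>A\<close>. Thus
  \<open>E \<union> A\<close>, and with it \<open>A\<close>, is not strongly porous, which means that the intervals within the blow
  up are short.\<close>

lemma blow_up_short_intervals:
  assumes "1 < q" "\<And>A. A \<in> SP \<Longrightarrow> strongly_porous (E \<union> A)"
  obtains M \<epsilon> where "1 < M" "0 < \<epsilon>"
    "\<And>t. 0 < t \<Longrightarrow> t < \<epsilon> \<Longrightarrow> \<not> {t/M<..<t} \<subseteq> blow_up q E"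
proof -
  define A where "A = Rplus - blow_up q E"
  have "\<not> strongly_porous (E \<union> A)"
  proof
    assume "strongly_porous (E \<union> A)"
    moreover have "1 < q * q"
      using assms(1) by (simp add: less_1_mult)
    ultimately obtain t where t: "0 < t" "{t/(q * q)<..<t} \<inter> (E \<union> A) = {}"
      unfolding strongly_porous_iff_gaps using zero_less_one by blast
    have "t/q \<notin> blow_up q E"
      using mem_blow_up_iff[of q "t/q" E] assms(1) t(2) by (auto simp: Int_Un_distrib)
    then have "t/q \<in> A"
      using t(1) assms(1) by (simp add: A_def)
    moreover have "t/q \<in> {t/(q * q)<..<t}"
      using t(1) assms(1) by (auto simp: field_simps)
    ultimately show False using t(2) by blast
  qed
  then have "A \<notin> SP" using assms(2) by blast
  then have "\<not> strongly_porous A" by (auto simp: SP_def A_def)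
  then obtain M \<epsilon> where M: "1 < M" and \<epsilon>: "0 < \<epsilon>"
    and no_gap: "\<And>t. 0 < t \<Longrightarrow> t < \<epsilon> \<Longrightarrow> {t/M<..<t} \<inter> A \<noteq> {}"
    unfolding strongly_porous_iff_gaps by blast
  have "\<not> {t/M<..<t} \<subseteq> blow_up q E" if "0 < t" "t < \<epsilon>" for t
    using no_gap[OF that] unfolding A_def by blast
  with M \<epsilon> show thesis by (rule that)
qed

theorem bounded_components_of_strongly_porous_Un:
  assumes E: "strongly_porous E" "E \<subseteq> Rplus" "0 \<in> closure (E - {0})"
    and union: "\<And>A. A \<in> SP \<Longrightarrow> strongly_porous (E \<union> A)" and q: "1 < q"
  shows "\<exists>a b. Cc1_enumeration (blow_up q E) a b \<and> limsup (\<lambda>i. ereal (b i / a i)) < \<infinity>"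
proof -
  interpret blow_up_components E q by unfold_locales (fact q)
  obtain a b where ab: "Cc1_enumeration (blow_up q E) a b" and lim: "b \<longlonglongrightarrow> 0"
    using Cc1_enumeration_exists[OF E] .
  obtain M \<epsilon> where M: "1 < M" and \<epsilon>: "0 < \<epsilon>"
    and short: "\<And>t. 0 < t \<Longrightarrow> t < \<epsilon> \<Longrightarrow> \<not> {t/M<..<t} \<subseteq> blow_up q E"
    using blow_up_short_intervals[OF q union] by blast
  note bounds = Cc1_enumeration_bounds[OF ab]
  have "b i / a i \<le> M" if "b i < \<epsilon>" for i
  proof (rule ccontr)
    assume "\<not> b i / a i \<le> M"
    then have "a i \<le> b i / M"
      using bounds(1)[of i] M by (simp add: field_simps)
    then have "{b i / M<..<b i} \<subseteq> {a i<..<b i}"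
      by auto
    also have "\<dots> \<subseteq> blow_up q E"
      using ab unfolding Cc1_enumeration_def by blast
    finally show False
      using short[OF _ that] bounds(1,2)[of i] by (meson less_trans)
  qed
  then have "\<forall>\<^sub>F i in sequentially. ereal (b i / a i) \<le> ereal M"
    using order_tendstoD(2)[OF lim \<epsilon>] by (auto elim: eventually_mono)
  then have "limsup (\<lambda>i. ereal (b i / a i)) \<le> ereal M"
    by (rule Limsup_bounded)
  then have "limsup (\<lambda>i. ereal (b i / a i)) < \<infinity>"
    by (rule le_less_trans) simp
  with ab show ?thesis by blast
qed

section \<open>The characterization of the intersection of the maximal ideals\<close>

lemma strongly_porous_Un_of_isolated_0:
  assumes "0 \<notin> closure (E - {0})" "E \<subseteq> Rplus" "strongly_porous A"
  shows "strongly_porous (E \<union> A)"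
  unfolding strongly_porous_iff_gaps
proof (intro allI impI)
  fix K \<epsilon> :: real
  assume K: "1 < K" and "0 < \<epsilon>"
  obtain \<delta> where \<delta>: "0 < \<delta>" "\<And>x. x \<in> E \<Longrightarrow> x \<noteq> 0 \<Longrightarrow> \<delta> \<le> \<bar>x\<bar>"
    using assms(1) unfolding closure_approachable by (force simp: dist_real_def)
  have "0 < min \<epsilon> \<delta>" using \<open>0 < \<epsilon>\<close> \<delta>(1) by simp
  with assms(3) K obtain t where t: "0 < t" "t < \<epsilon>" "t < \<delta>" "{t/K<..<t} \<inter> A = {}"
    unfolding strongly_porous_iff_gaps by (meson min_less_iff_conj)
  have "0 < t/K" using t(1) K by simp
  then have "{t/K<..<t} \<inter> E = {}"
    using \<delta>(2) t(3) by force
  with t show "\<exists>t. 0 < t \<and> t < \<epsilon> \<and> {t/K<..<t} \<inter> (E \<union> A) = {}"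
    by (intro exI[of _ t]) (simp add: Int_Un_distrib)
qed

theorem theorem3p6:
  fixes E :: "real set"
  assumes "E \<in> SP"
  shows "(E \<in> SP_hat \<longleftrightarrow> (\<forall>A\<in>SP. coherently_porous E A))
    \<and> ((\<forall>A\<in>SP. coherently_porous E A) \<longleftrightarrow> (\<forall>A\<in>SP. strongly_porous (E \<union> A)))
    \<and> ((\<forall>A\<in>SP. strongly_porous (E \<union> A)) \<longleftrightarrow>
        (0 \<notin> closure (E - {0}) \<or>
         (\<forall>q>1. \<exists>a b. Cc1_enumeration (blow_up q E) a b
                  \<and> limsup (\<lambda>i. ereal (b i / a i)) < \<infinity>)))"
proof -
  have E: "strongly_porous E" "E \<subseteq> Rplus"
    using assms by (auto simp: SP_def)
  have coherent: "(\<forall>A\<in>SP. coherently_porous E A) \<longleftrightarrow> (\<forall>A\<in>SP. strongly_porous (E \<union> A))"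
    using coherently_porous_iff_union[OF E(1)] by (simp add: SP_def)
  have "E \<in> SP_hat \<longleftrightarrow> (\<forall>A\<in>SP. strongly_porous (E \<union> A))"
    unfolding SP_hat_iff_union using E(2) by (simp add: SP_def)
  moreover have "(\<forall>A\<in>SP. strongly_porous (E \<union> A)) \<longleftrightarrow>
      (0 \<notin> closure (E - {0}) \<or>
         (\<forall>q>1. \<exists>a b. Cc1_enumeration (blow_up q E) a b
                  \<and> limsup (\<lambda>i. ereal (b i / a i)) < \<infinity>))" (is "?union \<longleftrightarrow> ?isolated \<or> ?bounded")
  proof
    assume ?union
    then show "?isolated \<or> ?bounded"
      using bounded_components_of_strongly_porous_Un[OF E] by auto
  next
    assume bounded: "?isolated \<or> ?bounded"
    show ?union
    proof
      fix A assume "A \<in> SP"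
      then have A: "strongly_porous A" by (simp add: SP_def)
      from bounded show "strongly_porous (E \<union> A)"
      proof
        assume ?isolated
        then show ?thesis by (rule strongly_porous_Un_of_isolated_0[OF _ E(2) A])
      next
        assume ?bounded
        then show ?thesis
          by (intro strongly_porous_Un_of_bounded_components[OF A]) blast
      qed
    qed
  qed
  ultimately show ?thesis
    unfolding coherent by (intro conjI) (rule refl | assumption)+
qed

end
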